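(* Let $\mathsf{G}$ be a group, let $H$ be a central subgroup of $\mathsf{G}$ with $[\mathsf{G}:H]<\infty$, and let $\mathsf{M}$ be an abelian group with the trivial $\mathsf{G}$-action. If $[\mathsf{G}:H]$ is invertible in $\mathsf{M}$, then $$\mathcal{H}^2(H,\mathsf{M})=\mathsf{res}^{\mathsf{G}}_H\left(\mathcal{H}^2(\mathsf{G},\mathsf{M})\right).$$
   Context: $\mathcal{H}^2(\mathsf{G},\mathsf{M})=\mathcal{Z}^2(\mathsf{G},\mathsf{M})/\mathcal{B}^2(\mathsf{G},\mathsf{M})$ is the second cohomology group. For trivial action and $\mathsf{M}$ written additively, a 2-cocycle is a map $\sigma:\mathsf{G}\times\mathsf{G}\to\mathsf{M}$ with $\sigma(\xi,\zeta)+\sigma(\xi\zeta,\varsigma)=\sigma(\zeta,\varsigma)+\sigma(\xi,\zeta\varsigma)$ for all $\xi,\zeta,\varsigma\in\mathsf{G}$, and a 2-coboundary is a map of the form $(\xi,\zeta)\mapsto f(\zeta)-f(\xi\zeta)+f(\xi)$ for some function $f:\mathsf{G}\to\mathsf{M}$. The restriction homomorphism $\mathsf{res}^{\mathsf{G}}_H:\mathcal{H}^2(\mathsf{G},\mathsf{M})\to\mathcal{H}^2(H,\mathsf{M})$ sends $[\sigma]$ to $[\sigma_H]$, where $\sigma_H$ is the restriction of $\sigma$ to $H\times H$. A positive integer $\lambda$ is invertible in $\mathsf{M}$ if the map $m\mapsto \lambda m=m+\cdots+m$ ($\lambda$ times) is an automorphism of $\mathsf{M}$. *)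

theory Defs
  imports "HOL-Algebra.Algebra"
begin

text \<open>
  The coefficient group \<open>M\<close> is an abelian group in the multiplicative notation of
  HOL-Algebra; \<open>G\<close> acts trivially on it. Cochains are extensional functions
  on pairs, so that two cochains are equal iff they agree on \<open>carrier G \<times> carrier G\<close>.
  Cocycles are not assumed to be normalised.
\<close>

definition cocycles2 ::
  "('a, 'c) monoid_scheme \<Rightarrow> ('b, 'd) monoid_scheme \<Rightarrow> ('a \<times> 'a \<Rightarrow> 'b) set"
  where "cocycles2 G M =
    {\<sigma> \<in> carrier G \<times> carrier G \<rightarrow>\<^sub>E carrier M.
      \<forall>x\<in>carrier G. \<forall>y\<in>carrier G. \<forall>z\<in>carrier G.
        \<sigma> (x, y) \<otimes>\<^bsub>M\<^esub> \<sigma> (x \<otimes>\<^bsub>G\<^esub> y, z) = \<sigma> (y, z) \<otimes>\<^bsub>M\<^esub> \<sigma> (x, y \<otimes>\<^bsub>G\<^esub> z)}"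

definition coboundary2 ::
  "('a, 'c) monoid_scheme \<Rightarrow> ('b, 'd) monoid_scheme \<Rightarrow> ('a \<Rightarrow> 'b) \<Rightarrow> 'a \<times> 'a \<Rightarrow> 'b"
  where "coboundary2 G M f =
    (\<lambda>(x, y) \<in> carrier G \<times> carrier G. f y \<otimes>\<^bsub>M\<^esub> inv\<^bsub>M\<^esub> f (x \<otimes>\<^bsub>G\<^esub> y) \<otimes>\<^bsub>M\<^esub> f x)"

definition coboundaries2 ::
  "('a, 'c) monoid_scheme \<Rightarrow> ('b, 'd) monoid_scheme \<Rightarrow> ('a \<times> 'a \<Rightarrow> 'b) set"
  where "coboundaries2 G M = coboundary2 G M ` (carrier G \<rightarrow> carrier M)"

definition cocycle2_group ::
  "('a, 'c) monoid_scheme \<Rightarrow> ('b, 'd) monoid_scheme \<Rightarrow> ('a \<times> 'a \<Rightarrow> 'b) monoid"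
  where "cocycle2_group G M =
    (product_group (carrier G \<times> carrier G) (\<lambda>_. M)) \<lparr>carrier := cocycles2 G M\<rparr>"

definition cohomology2 ::
  "('a, 'c) monoid_scheme \<Rightarrow> ('b, 'd) monoid_scheme \<Rightarrow> ('a \<times> 'a \<Rightarrow> 'b) set monoid"
  where "cohomology2 G M = cocycle2_group G M Mod coboundaries2 G M"

definition cohomology2_class ::
  "('a, 'c) monoid_scheme \<Rightarrow> ('b, 'd) monoid_scheme \<Rightarrow> ('a \<times> 'a \<Rightarrow> 'b) \<Rightarrow> ('a \<times> 'a \<Rightarrow> 'b) set"
  where "cohomology2_class G M \<sigma> = coboundaries2 G M #>\<^bsub>cocycle2_group G M\<^esub> \<sigma>"

text \<open>
  For \<open>C\<close> in \<open>carrier (cohomology2 G M)\<close> the image below is a singleton, because the class of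
  the restriction does not depend on the representative; see \<open>restriction2_class\<close>.
\<close>

definition restriction2 ::
  "('a, 'c) monoid_scheme \<Rightarrow> 'a set \<Rightarrow> ('b, 'd) monoid_scheme
    \<Rightarrow> ('a \<times> 'a \<Rightarrow> 'b) set \<Rightarrow> ('a \<times> 'a \<Rightarrow> 'b) set"
  where "restriction2 G H M C =
    the_elem ((\<lambda>\<sigma>. cohomology2_class (G\<lparr>carrier := H\<rparr>) M (restrict \<sigma> (H \<times> H))) ` C)"

definition central_subgroup :: "'a set \<Rightarrow> ('a, 'c) monoid_scheme \<Rightarrow> bool"
  where "central_subgroup H G \<longleftrightarrow>
    subgroup H G \<and> (\<forall>h\<in>H. \<forall>g\<in>carrier G. h \<otimes>\<^bsub>G\<^esub> g = g \<otimes>\<^bsub>G\<^esub> h)"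

definition invertible_in :: "nat \<Rightarrow> ('b, 'd) monoid_scheme \<Rightarrow> bool"
  where "invertible_in n M \<longleftrightarrow> n > 0 \<and> (\<lambda>m. m [^]\<^bsub>M\<^esub> n) \<in> iso M M"

lemma m_ac_comm_group:
  assumes "comm_group M"
    "a \<in> carrier M" "b \<in> carrier M" "c \<in> carrier M" "d \<in> carrier M"
  shows "(a \<otimes>\<^bsub>M\<^esub> b) \<otimes>\<^bsub>M\<^esub> (c \<otimes>\<^bsub>M\<^esub> d) = (a \<otimes>\<^bsub>M\<^esub> c) \<otimes>\<^bsub>M\<^esub> (b \<otimes>\<^bsub>M\<^esub> d)"
proof -
  interpret comm_group M by fact
  show ?thesis using assms(2-) by (simp add: m_ac)
qed

lemma subgroup_cocycles2:
  assumes "group G" "comm_group M"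
  shows "subgroup (cocycles2 G M) (product_group (carrier G \<times> carrier G) (\<lambda>_. M))"
proof -
  interpret G: group G by fact
  interpret M: comm_group M by fact
  let ?P = "product_group (carrier G \<times> carrier G) (\<lambda>_. M)"
  interpret P: group ?P by simp
  show ?thesis
  proof (rule P.subgroupI)
    show "cocycles2 G M \<subseteq> carrier ?P"
      by (auto simp: cocycles2_def)
    have "\<one>\<^bsub>?P\<^esub> \<in> cocycles2 G M"
      by (auto simp: cocycles2_def)
    then show "cocycles2 G M \<noteq> {}" by blast
  next
    fix s assume s: "s \<in> cocycles2 G M"
    then have sP: "s \<in> carrier G \<times> carrier G \<rightarrow>\<^sub>E carrier M"
      by (simp add: cocycles2_def)
    have cl: "s (x, y) \<in> carrier M" if "x \<in> carrier G" "y \<in> carrier G" for x y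
      using sP that by auto
    have "inv\<^bsub>M\<^esub> s (x, y) \<otimes>\<^bsub>M\<^esub> inv\<^bsub>M\<^esub> s (x \<otimes>\<^bsub>G\<^esub> y, z)
        = inv\<^bsub>M\<^esub> s (y, z) \<otimes>\<^bsub>M\<^esub> inv\<^bsub>M\<^esub> s (x, y \<otimes>\<^bsub>G\<^esub> z)"
      if "x \<in> carrier G" "y \<in> carrier G" "z \<in> carrier G" for x y z
    proof -
      have "s (x, y) \<otimes>\<^bsub>M\<^esub> s (x \<otimes>\<^bsub>G\<^esub> y, z) = s (y, z) \<otimes>\<^bsub>M\<^esub> s (x, y \<otimes>\<^bsub>G\<^esub> z)"
        using s that by (simp add: cocycles2_def)
      then show ?thesis
        using that by (simp add: cl flip: M.inv_mult)
    qed
    then show "inv\<^bsub>?P\<^esub> s \<in> cocycles2 G M"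
      using sP by (auto simp: cocycles2_def cl)
  next
    fix s t assume s: "s \<in> cocycles2 G M" and t: "t \<in> cocycles2 G M"
    then have sP: "s \<in> carrier G \<times> carrier G \<rightarrow>\<^sub>E carrier M"
      and tP: "t \<in> carrier G \<times> carrier G \<rightarrow>\<^sub>E carrier M"
      by (simp_all add: cocycles2_def)
    have cl: "s (x, y) \<in> carrier M" "t (x, y) \<in> carrier M"
      if "x \<in> carrier G" "y \<in> carrier G" for x y
      using sP tP that by auto
    have "(s (x, y) \<otimes>\<^bsub>M\<^esub> t (x, y)) \<otimes>\<^bsub>M\<^esub> (s (x \<otimes>\<^bsub>G\<^esub> y, z) \<otimes>\<^bsub>M\<^esub> t (x \<otimes>\<^bsub>G\<^esub> y, z))
        = (s (y, z) \<otimes>\<^bsub>M\<^esub> t (y, z)) \<otimes>\<^bsub>M\<^esub> (s (x, y \<otimes>\<^bsub>G\<^esub> z) \<otimes>\<^bsub>M\<^esub> t (x, y \<otimes>\<^bsub>G\<^esub> z))"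
      if "x \<in> carrier G" "y \<in> carrier G" "z \<in> carrier G" for x y z
    proof -
      have "(s (x, y) \<otimes>\<^bsub>M\<^esub> t (x, y)) \<otimes>\<^bsub>M\<^esub> (s (x \<otimes>\<^bsub>G\<^esub> y, z) \<otimes>\<^bsub>M\<^esub> t (x \<otimes>\<^bsub>G\<^esub> y, z))
          = (s (x, y) \<otimes>\<^bsub>M\<^esub> s (x \<otimes>\<^bsub>G\<^esub> y, z)) \<otimes>\<^bsub>M\<^esub> (t (x, y) \<otimes>\<^bsub>M\<^esub> t (x \<otimes>\<^bsub>G\<^esub> y, z))"
        using that by (intro m_ac_comm_group[OF assms(2)]) (simp_all add: cl)
      also have "\<dots> = (s (y, z) \<otimes>\<^bsub>M\<^esub> s (x, y \<otimes>\<^bsub>G\<^esub> z)) \<otimes>\<^bsub>M\<^esub> (t (y, z) \<otimes>\<^bsub>M\<^esub> t (x, y \<otimes>\<^bsub>G\<^esub> z))"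
        using s t that by (simp add: cocycles2_def)
      also have "\<dots> = (s (y, z) \<otimes>\<^bsub>M\<^esub> t (y, z)) \<otimes>\<^bsub>M\<^esub> (s (x, y \<otimes>\<^bsub>G\<^esub> z) \<otimes>\<^bsub>M\<^esub> t (x, y \<otimes>\<^bsub>G\<^esub> z))"
        using that by (intro m_ac_comm_group[OF assms(2)]) (simp_all add: cl)
      finally show ?thesis .
    qed
    then show "s \<otimes>\<^bsub>?P\<^esub> t \<in> cocycles2 G M"
      by (auto simp: cocycles2_def cl)
  qed
qed

lemma comm_group_cocycle2_group:
  assumes "group G" "comm_group M"
  shows "comm_group (cocycle2_group G M)"
proof -
  interpret M: comm_group M by fact
  have "group (cocycle2_group G M)"
    unfolding cocycle2_group_def
    by (rule subgroup.subgroup_is_group[OF subgroup_cocycles2[OF assms]]) simp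
  moreover have "s \<otimes>\<^bsub>cocycle2_group G M\<^esub> t = t \<otimes>\<^bsub>cocycle2_group G M\<^esub> s"
    if "s \<in> carrier (cocycle2_group G M)" "t \<in> carrier (cocycle2_group G M)" for s t
  proof -
    have "s p \<otimes>\<^bsub>M\<^esub> t p = t p \<otimes>\<^bsub>M\<^esub> s p" if "p \<in> carrier G \<times> carrier G" for p
      using that \<open>s \<in> _\<close> \<open>t \<in> _\<close>
      by (intro M.m_comm) (auto simp: cocycle2_group_def cocycles2_def)
    then show ?thesis
      by (auto simp: cocycle2_group_def intro: restrict_ext)
  qed
  ultimately show ?thesis
    by (rule group.group_comm_groupI)
qed

lemma coboundary2_in_cocycles2:
  assumes "group G" "comm_group M" "f \<in> carrier G \<rightarrow> carrier M"
  shows "coboundary2 G M f \<in> cocycles2 G M"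
proof -
  interpret G: group G by fact
  interpret M: comm_group M by fact
  have cl: "f x \<in> carrier M" if "x \<in> carrier G" for x
    using assms(3) that by auto
  have cancel: "(b \<otimes>\<^bsub>M\<^esub> inv\<^bsub>M\<^esub> d \<otimes>\<^bsub>M\<^esub> a) \<otimes>\<^bsub>M\<^esub> (c \<otimes>\<^bsub>M\<^esub> inv\<^bsub>M\<^esub> e \<otimes>\<^bsub>M\<^esub> d)
      = a \<otimes>\<^bsub>M\<^esub> b \<otimes>\<^bsub>M\<^esub> c \<otimes>\<^bsub>M\<^esub> inv\<^bsub>M\<^esub> e"
    if "a \<in> carrier M" "b \<in> carrier M" "c \<in> carrier M" "d \<in> carrier M" "e \<in> carrier M"
    for a b c d e
  proof -
    have "(b \<otimes>\<^bsub>M\<^esub> u \<otimes>\<^bsub>M\<^esub> a) \<otimes>\<^bsub>M\<^esub> (c \<otimes>\<^bsub>M\<^esub> v \<otimes>\<^bsub>M\<^esub> d)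
        = (d \<otimes>\<^bsub>M\<^esub> u) \<otimes>\<^bsub>M\<^esub> (a \<otimes>\<^bsub>M\<^esub> b \<otimes>\<^bsub>M\<^esub> c \<otimes>\<^bsub>M\<^esub> v)"
      if "u \<in> carrier M" "v \<in> carrier M" for u v
      using \<open>a \<in> _\<close> \<open>b \<in> _\<close> \<open>c \<in> _\<close> \<open>d \<in> _\<close> that
      by (simp add: M.m_ac)
    from this[of "inv\<^bsub>M\<^esub> d" "inv\<^bsub>M\<^esub> e"] show ?thesis
      using that by simp
  qed
  have cancel': "(c \<otimes>\<^bsub>M\<^esub> inv\<^bsub>M\<^esub> d \<otimes>\<^bsub>M\<^esub> b) \<otimes>\<^bsub>M\<^esub> (d \<otimes>\<^bsub>M\<^esub> inv\<^bsub>M\<^esub> e \<otimes>\<^bsub>M\<^esub> a)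
      = a \<otimes>\<^bsub>M\<^esub> b \<otimes>\<^bsub>M\<^esub> c \<otimes>\<^bsub>M\<^esub> inv\<^bsub>M\<^esub> e"
    if "a \<in> carrier M" "b \<in> carrier M" "c \<in> carrier M" "d \<in> carrier M" "e \<in> carrier M"
    for a b c d e
  proof -
    have "(c \<otimes>\<^bsub>M\<^esub> u \<otimes>\<^bsub>M\<^esub> b) \<otimes>\<^bsub>M\<^esub> (d \<otimes>\<^bsub>M\<^esub> v \<otimes>\<^bsub>M\<^esub> a)
        = (d \<otimes>\<^bsub>M\<^esub> u) \<otimes>\<^bsub>M\<^esub> (a \<otimes>\<^bsub>M\<^esub> b \<otimes>\<^bsub>M\<^esub> c \<otimes>\<^bsub>M\<^esub> v)"
      if "u \<in> carrier M" "v \<in> carrier M" for u v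
      using \<open>a \<in> _\<close> \<open>b \<in> _\<close> \<open>c \<in> _\<close> \<open>d \<in> _\<close> that
      by (simp add: M.m_ac)
    from this[of "inv\<^bsub>M\<^esub> d" "inv\<^bsub>M\<^esub> e"] show ?thesis
      using that by simp
  qed
  have "coboundary2 G M f \<in> carrier G \<times> carrier G \<rightarrow>\<^sub>E carrier M"
    by (auto simp: coboundary2_def cl)
  then show ?thesis
    by (simp add: cocycles2_def) (simp add: coboundary2_def cl cancel cancel' G.m_assoc)
qed

lemma subgroup_coboundaries2:
  assumes "group G" "comm_group M"
  shows "subgroup (coboundaries2 G M) (cocycle2_group G M)"
proof -
  interpret G: group G by fact
  interpret M: comm_group M by fact
  interpret Z: comm_group "cocycle2_group G M"
    by (rule comm_group_cocycle2_group[OF assms])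
  let ?P = "product_group (carrier G \<times> carrier G) (\<lambda>_. M)"
  show ?thesis
  proof (rule Z.subgroupI)
    show "coboundaries2 G M \<subseteq> carrier (cocycle2_group G M)"
      using coboundary2_in_cocycles2[OF assms]
      by (auto simp: coboundaries2_def cocycle2_group_def)
    have "(\<lambda>_. \<one>\<^bsub>M\<^esub>) \<in> carrier G \<rightarrow> carrier M" by simp
    then show "coboundaries2 G M \<noteq> {}"
      unfolding coboundaries2_def by blast
  next
    fix s assume "s \<in> coboundaries2 G M"
    then obtain f where f: "f \<in> carrier G \<rightarrow> carrier M" and s: "s = coboundary2 G M f"
      by (auto simp: coboundaries2_def)
    have cl: "f x \<in> carrier M" if "x \<in> carrier G" for x
      using f that by auto
    have sZ: "s \<in> cocycles2 G M"
      using coboundary2_in_cocycles2[OF assms f] s by simp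
    have "inv\<^bsub>cocycle2_group G M\<^esub> s = inv\<^bsub>?P\<^esub> s"
      unfolding cocycle2_group_def
      by (rule group.m_inv_consistent[OF _ subgroup_cocycles2[OF assms] sZ]) simp
    also have "\<dots> = (\<lambda>p\<in>carrier G \<times> carrier G. inv\<^bsub>M\<^esub> s p)"
      using sZ by (simp add: cocycles2_def)
    also have "\<dots> = coboundary2 G M (\<lambda>x. inv\<^bsub>M\<^esub> f x)"
      by (auto simp: s coboundary2_def cl M.inv_mult intro!: restrict_ext)
    finally show "inv\<^bsub>cocycle2_group G M\<^esub> s \<in> coboundaries2 G M"
      unfolding coboundaries2_def by (auto simp: cl)
  next
    fix s t assume "s \<in> coboundaries2 G M" "t \<in> coboundaries2 G M"
    then obtain f g where f: "f \<in> carrier G \<rightarrow> carrier M" "g \<in> carrier G \<rightarrow> carrier M"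
      and s: "s = coboundary2 G M f" "t = coboundary2 G M g"
      by (auto simp: coboundaries2_def)
    have cl: "f x \<in> carrier M" "g x \<in> carrier M" if "x \<in> carrier G" for x
      using f that by auto
    have "s \<otimes>\<^bsub>cocycle2_group G M\<^esub> t = coboundary2 G M (\<lambda>x. f x \<otimes>\<^bsub>M\<^esub> g x)"
      by (auto simp: cocycle2_group_def s coboundary2_def cl M.inv_mult M.m_ac
          intro!: restrict_ext)
    then show "s \<otimes>\<^bsub>cocycle2_group G M\<^esub> t \<in> coboundaries2 G M"
      unfolding coboundaries2_def by (auto simp: cl)
  qed
qed

lemma comm_group_cohomology2:
  assumes "group G" "comm_group M"
  shows "comm_group (cohomology2 G M)"
  unfolding cohomology2_def
  by (intro comm_group.abelian_FactGroup comm_group_cocycle2_group subgroup_coboundaries2 assms)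

lemma carrier_cohomology2:
  "carrier (cohomology2 G M) = cohomology2_class G M ` cocycles2 G M"
  by (auto simp: cohomology2_def carrier_FactGroup cohomology2_class_def cocycle2_group_def)

lemma restrict_cocycles2:
  assumes "subgroup H G" "\<sigma> \<in> cocycles2 G M"
  shows "restrict \<sigma> (H \<times> H) \<in> cocycles2 (G\<lparr>carrier := H\<rparr>) M"
proof -
  interpret H: subgroup H G by fact
  have "\<sigma> \<in> carrier G \<times> carrier G \<rightarrow>\<^sub>E carrier M"
    using assms(2) by (simp add: cocycles2_def)
  then have "\<sigma> (x, y) \<in> carrier M" if "x \<in> H" "y \<in> H" for x y
    using that by (auto simp: PiE_iff)
  then show ?thesis
    using assms(2) by (auto simp: cocycles2_def)
qed

lemma restriction2_class:
  assumes "group G" "comm_group M" "subgroup H G" "\<sigma> \<in> cocycles2 G M"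
  shows "restriction2 G H M (cohomology2_class G M \<sigma>)
    = cohomology2_class (G\<lparr>carrier := H\<rparr>) M (restrict \<sigma> (H \<times> H))"
proof -
  interpret G: group G by fact
  interpret M: comm_group M by fact
  interpret H: subgroup H G by fact
  let ?H = "G\<lparr>carrier := H\<rparr>"
  let ?r = "\<lambda>\<sigma>. restrict \<sigma> (H \<times> H)"
  have gH: "group ?H" by (rule H.subgroup_is_group[OF \<open>group G\<close>])
  interpret Z: comm_group "cocycle2_group G M"
    by (rule comm_group_cocycle2_group[OF assms(1,2)])
  interpret ZH: comm_group "cocycle2_group ?H M"
    by (rule comm_group_cocycle2_group[OF gH assms(2)])
  have sub: "subgroup (coboundaries2 ?H M) (cocycle2_group ?H M)"
    by (rule subgroup_coboundaries2[OF gH assms(2)])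
  have same: "cohomology2_class ?H M (?r \<tau>) = cohomology2_class ?H M (?r \<sigma>)"
    if \<tau>: "\<tau> \<in> cohomology2_class G M \<sigma>" for \<tau>
  proof -
    obtain f where f: "f \<in> carrier G \<rightarrow> carrier M"
      and t: "\<tau> = coboundary2 G M f \<otimes>\<^bsub>cocycle2_group G M\<^esub> \<sigma>"
      using \<tau> by (auto simp: cohomology2_class_def r_coset_def coboundaries2_def)
    have fH: "f \<in> H \<rightarrow> carrier M" using f H.subset by auto
    have "?r \<tau> = coboundary2 ?H M f \<otimes>\<^bsub>cocycle2_group ?H M\<^esub> ?r \<sigma>"
      by (auto simp: t cocycle2_group_def coboundary2_def H.mem_carrier intro!: restrict_ext)
    moreover have "coboundary2 ?H M f \<in> coboundaries2 ?H M"
      using fH by (simp add: coboundaries2_def)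
    ultimately have "?r \<tau> \<in> cohomology2_class ?H M (?r \<sigma>)"
      unfolding cohomology2_class_def r_coset_def by blast
    moreover have "?r \<sigma> \<in> carrier (cocycle2_group ?H M)"
      using restrict_cocycles2[OF assms(3,4)] by (simp add: cocycle2_group_def)
    ultimately show ?thesis
      unfolding cohomology2_class_def using ZH.repr_independence[OF _ _ sub] by metis
  qed
  have "\<sigma> \<in> cohomology2_class G M \<sigma>"
    unfolding cohomology2_class_def
    by (rule Z.rcos_self[OF _ subgroup_coboundaries2[OF assms(1,2)]])
      (simp add: cocycle2_group_def assms(4))
  with same have "(\<lambda>\<tau>. cohomology2_class ?H M (?r \<tau>)) ` cohomology2_class G M \<sigma>
      = {cohomology2_class ?H M (?r \<sigma>)}"
    by blast
  then show ?thesis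
    by (simp add: restriction2_def)
qed

lemma restriction2_hom:
  assumes "group G" "comm_group M" "subgroup H G"
  shows "restriction2 G H M \<in> hom (cohomology2 G M) (cohomology2 (G\<lparr>carrier := H\<rparr>) M)"
proof -
  interpret G: group G by fact
  interpret H: subgroup H G by fact
  let ?H = "G\<lparr>carrier := H\<rparr>"
  have mult: "cohomology2_class K M s \<otimes>\<^bsub>cohomology2 K M\<^esub> cohomology2_class K M t
      = cohomology2_class K M (s \<otimes>\<^bsub>cocycle2_group K M\<^esub> t)"
    if "group K" "s \<in> cocycles2 K M" "t \<in> cocycles2 K M" for K :: "('a, 'b) monoid_scheme" and s t
  proof -
    interpret Z: comm_group "cocycle2_group K M"
      by (rule comm_group_cocycle2_group[OF that(1) assms(2)])
    have "coboundaries2 K M \<lhd> cocycle2_group K M"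
      by (rule Z.subgroup_imp_normal[OF subgroup_coboundaries2[OF that(1) assms(2)]])
    from normal.rcos_sum[OF this] show ?thesis
      using that by (simp add: cohomology2_def cohomology2_class_def cocycle2_group_def)
  qed
  have gH: "group ?H" by (rule H.subgroup_is_group[OF \<open>group G\<close>])
  show ?thesis
  proof (rule homI)
    fix A assume "A \<in> carrier (cohomology2 G M)"
    then show "restriction2 G H M A \<in> carrier (cohomology2 ?H M)"
      by (auto simp: carrier_cohomology2 restriction2_class[OF assms]
          intro: restrict_cocycles2[OF assms(3)])
  next
    fix A B assume "A \<in> carrier (cohomology2 G M)" "B \<in> carrier (cohomology2 G M)"
    then obtain s t where st: "s \<in> cocycles2 G M" "t \<in> cocycles2 G M"
      and AY: "A = cohomology2_class G M s" "B = cohomology2_class G M t"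
      by (auto simp: carrier_cohomology2)
    interpret Z: comm_group "cocycle2_group G M"
      by (rule comm_group_cocycle2_group[OF assms(1,2)])
    have stZ: "s \<otimes>\<^bsub>cocycle2_group G M\<^esub> t \<in> cocycles2 G M"
      using Z.m_closed[of s t] st by (simp add: cocycle2_group_def)
    have "restrict (s \<otimes>\<^bsub>cocycle2_group G M\<^esub> t) (H \<times> H)
        = restrict s (H \<times> H) \<otimes>\<^bsub>cocycle2_group ?H M\<^esub> restrict t (H \<times> H)"
      by (auto simp: cocycle2_group_def H.mem_carrier intro!: restrict_ext)
    then show "restriction2 G H M (A \<otimes>\<^bsub>cohomology2 G M\<^esub> B)
        = restriction2 G H M A \<otimes>\<^bsub>cohomology2 ?H M\<^esub> restriction2 G H M B"
      using st stZ assms gH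
      by (simp add: AY mult restriction2_class restrict_cocycles2)
  qed
qed

end

theory Submission
  imports Defs
begin

text \<open>
  Fix representatives \<open>t\<^sub>C\<close> of the right cosets of \<open>H\<close> and write
  \<open>t\<^sub>C x = h\<^sub>C(x) t\<^sub>C\<^sub>x\<close> with \<open>h\<^sub>C(x) \<in> H\<close>. The corestriction of a cocycle \<open>\<sigma>\<close> on \<open>H\<close> is
  \<open>(x, y) \<mapsto> \<Prod>\<^sub>C \<sigma>(h\<^sub>C(x), h\<^sub>C\<^sub>x(y))\<close>. If \<open>H\<close> is central, then \<open>h\<^sub>C(x) = x\<close> and
  \<open>C x = C\<close> for \<open>x \<in> H\<close>, so restricting the corestriction of \<open>\<sigma>\<close> to \<open>H\<close> gives exactly \<open>\<sigma>\<^sup>n\<close>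
  with \<open>n = [G : H]\<close>. Every cocycle on \<open>H\<close> is such an \<open>n\<close>-th power, because taking \<open>n\<close>-th powers
  is an automorphism of \<open>M\<close>.
\<close>

text \<open>This is \<open>h_C(x)\<close> of the overview. The product of these factors over all
  cosets, taken modulo commutators of \<open>H\<close>, is the classical transfer for finite
  index.\<close>

definition coset_factor ::
  "('a, 'c) monoid_scheme \<Rightarrow> ('a set \<Rightarrow> 'a) \<Rightarrow> 'a set \<Rightarrow> 'a \<Rightarrow> 'a"
  where "coset_factor G t C x = t C \<otimes>\<^bsub>G\<^esub> x \<otimes>\<^bsub>G\<^esub> inv\<^bsub>G\<^esub> t (C #>\<^bsub>G\<^esub> x)"

text \<open>The cochain depends on the choice of representatives, so \<open>t\<close> is a
  parameter. Over infinitely many cosets \<open>finprod\<close> takes its default value one.\<close>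

definition corestriction2 ::
  "('a, 'c) monoid_scheme \<Rightarrow> 'a set \<Rightarrow> ('b, 'd) monoid_scheme \<Rightarrow> ('a set \<Rightarrow> 'a)
    \<Rightarrow> ('a \<times> 'a \<Rightarrow> 'b) \<Rightarrow> 'a \<times> 'a \<Rightarrow> 'b"
  where "corestriction2 G H M t \<sigma> =
    (\<lambda>(x, y) \<in> carrier G \<times> carrier G.
      \<Otimes>\<^bsub>M\<^esub>C\<in>rcosets\<^bsub>G\<^esub> H. \<sigma> (coset_factor G t C x, coset_factor G t (C #>\<^bsub>G\<^esub> x) y))"

text \<open>Functoriality in the coefficients: \<open>\<phi>\<close> carries the cocycle identity
  from \<open>M\<close> to \<open>N\<close>. It serves to take roots of a cocycle value by
  value.\<close>

lemma map_cocycles2: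
  assumes "group G" "\<phi> \<in> hom M N" "\<sigma> \<in> cocycles2 G M"
  shows "(\<lambda>p \<in> carrier G \<times> carrier G. \<phi> (\<sigma> p)) \<in> cocycles2 G N"
proof -
  interpret G: group G by fact
  have \<sigma>: "\<sigma> (x, y) \<in> carrier M" if "x \<in> carrier G" "y \<in> carrier G" for x y
    using assms(3) that by (auto simp: cocycles2_def PiE_iff)
  have "\<phi> (\<sigma> (x, y)) \<otimes>\<^bsub>N\<^esub> \<phi> (\<sigma> (x \<otimes>\<^bsub>G\<^esub> y, z)) = \<phi> (\<sigma> (y, z)) \<otimes>\<^bsub>N\<^esub> \<phi> (\<sigma> (x, y \<otimes>\<^bsub>G\<^esub> z))"
    if "x \<in> carrier G" "y \<in> carrier G" "z \<in> carrier G" for x y z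
    using assms(3) that by (simp add: cocycles2_def \<sigma> flip: hom_mult[OF assms(2)])
  then show ?thesis
    by (auto simp: cocycles2_def \<sigma> hom_in_carrier[OF assms(2)])
qed

context group
begin

lemma r_coset_in_rcosets:
  assumes "subgroup H G" "C \<in> rcosets H" "x \<in> carrier G"
  shows "C #> x \<in> rcosets H"
  using assms by (auto simp: RCOSETS_def coset_mult_assoc subgroup.subset)

lemma r_coset_r_coset:
  assumes "subgroup H G" "C \<in> rcosets H" "x \<in> carrier G" "y \<in> carrier G"
  shows "(C #> x) #> y = C #> (x \<otimes> y)"
  using subgroup.rcosets_carrier[OF assms(1) is_group assms(2)] assms(3,4) by (rule coset_mult_assoc)

lemma bij_betw_r_coset_rcosets:
  assumes "subgroup H G" "x \<in> carrier G"
  shows "bij_betw (\<lambda>C. C #> x) (rcosets H) (rcosets H)"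
  by (rule bij_betw_byWitness[where f' = "\<lambda>C. C #> inv x"])
    (auto simp: assms r_coset_in_rcosets r_coset_r_coset[OF assms(1)] coset_mult_one
        subgroup.rcosets_carrier[OF assms(1) is_group])

lemma representative_in_carrier:
  assumes "subgroup H G" "\<And>C. C \<in> rcosets H \<Longrightarrow> t C \<in> C" "C \<in> rcosets H"
  shows "t C \<in> carrier G"
  using assms(2,3) subgroup.rcosets_carrier[OF assms(1) is_group] by blast

text \<open>Both \<open>t C \<otimes> x\<close> and \<open>t (C #> x)\<close> lie in the right coset
  \<open>C #> x\<close>, so their quotient lies in \<open>H\<close>.\<close>

lemma coset_factor_in_subgroup:
  assumes H: "subgroup H G" and t: "\<And>C. C \<in> rcosets H \<Longrightarrow> t C \<in> C"
    and C: "C \<in> rcosets H" and x: "x \<in> carrier G"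
  shows "coset_factor G t C x \<in> H"
proof -
  interpret H: subgroup H G by fact
  have Cx: "C #> x \<in> rcosets H"
    using H C x by (rule r_coset_in_rcosets)
  obtain a where a: "a \<in> carrier G" "C = H #> a"
    using C by (auto simp: RCOSETS_def)
  obtain k where k: "k \<in> H" "t C = k \<otimes> a"
    using t[OF C] a by (auto simp: r_coset_def)
  obtain l where l: "l \<in> H" "t (C #> x) = l \<otimes> (a \<otimes> x)"
  proof -
    have "C #> x = H #> (a \<otimes> x)"
      using a x by (simp add: coset_mult_assoc H.subset)
    then show thesis
      using t[OF Cx] that by (auto simp: r_coset_def)
  qed
  have "coset_factor G t C x = k \<otimes> inv l"
  proof -
    \<comment> \<open>An atomic \<open>b\<close> stands for \<open>a \<otimes> x\<close>, so that
      \<open>inv_mult_group\<close> does not split the inverse of that product.\<close>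
    have "k \<otimes> b \<otimes> inv (l \<otimes> b) = k \<otimes> inv l" if "b \<in> carrier G" for b
      using that k l by (simp add: inv_mult_group m_assoc) (simp flip: m_assoc)
    from this[of "a \<otimes> x"] show ?thesis
      using a k l x by (simp add: coset_factor_def m_assoc)
  qed
  then show ?thesis
    using k l by simp
qed

text \<open>Telescoping: between the two factors on the right, \<open>inv t (C #> x)\<close> cancels
  against \<open>t (C #> x)\<close>.\<close>

lemma coset_factor_mult:
  assumes H: "subgroup H G" and t: "\<And>C. C \<in> rcosets H \<Longrightarrow> t C \<in> C"
    and C: "C \<in> rcosets H" and xy: "x \<in> carrier G" "y \<in> carrier G"
  shows "coset_factor G t C (x \<otimes> y) = coset_factor G t C x \<otimes> coset_factor G t (C #> x) y"
proof -
  have "C #> x \<in> rcosets H" "C #> (x \<otimes> y) \<in> rcosets H"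
    using H C xy by (auto intro: r_coset_in_rcosets)
  then have "t C \<in> carrier G" "t (C #> x) \<in> carrier G" "t (C #> (x \<otimes> y)) \<in> carrier G"
    using representative_in_carrier[OF H t] C by auto
  then show ?thesis
    using H C xy by (simp add: coset_factor_def r_coset_r_coset m_assoc inv_solve_left)
qed

text \<open>An element \<open>x\<close> of \<open>H\<close> moves past any representative
  \<open>a\<close>, and \<open>H\<close> absorbs it:
  \<open>H #> (a \<otimes> x) = H #> (x \<otimes> a) = H #> a\<close>. Then \<open>t C\<close>
  commutes with \<open>x\<close> and cancels.\<close>

lemma coset_factor_central:
  assumes H: "central_subgroup H G" and t: "\<And>C. C \<in> rcosets H \<Longrightarrow> t C \<in> C"
    and C: "C \<in> rcosets H" and x: "x \<in> H"
  shows "C #> x = C" "coset_factor G t C x = x"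
proof -
  have sub: "subgroup H G" and comm: "\<And>h g. h \<in> H \<Longrightarrow> g \<in> carrier G \<Longrightarrow> h \<otimes> g = g \<otimes> h"
    using H by (auto simp: central_subgroup_def)
  interpret H: subgroup H G by (rule sub)
  obtain a where a: "a \<in> carrier G" "C = H #> a"
    using C by (auto simp: RCOSETS_def)
  have "C #> x = H #> (x \<otimes> a)"
    using a x comm by (simp add: coset_mult_assoc H.subset)
  also have "\<dots> = C"
    using a x by (simp add: H.subset coset_join2 sub flip: coset_mult_assoc)
  finally show Cx: "C #> x = C" .
  have "t C \<in> carrier G"
    using representative_in_carrier[OF sub t] C by auto
  then show "coset_factor G t C x = x"
    using x by (simp add: coset_factor_def Cx m_assoc flip: comm)
qed

text \<open>For each coset \<open>C\<close>, the cocycle identity of \<open>\<sigma>\<close> is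
  applied to the three factors of \<open>x\<close> at \<open>C\<close>, of \<open>y\<close> at
  \<open>C #> x\<close> and of \<open>z\<close> at \<open>(C #> x) #> y\<close>. By
  \<open>coset_factor_mult\<close> their products are factors of \<open>x \<otimes> y\<close> and
  \<open>y \<otimes> z\<close>. Multiplying over all \<open>C\<close> gives the claim up to a shift
  of the index.\<close>

lemma corestriction2_in_cocycles2:
  assumes H: "subgroup H G" and t: "\<And>C. C \<in> rcosets H \<Longrightarrow> t C \<in> C"
    and M: "comm_group M" and \<sigma>: "\<sigma> \<in> cocycles2 (G\<lparr>carrier := H\<rparr>) M"
  shows "corestriction2 G H M t \<sigma> \<in> cocycles2 G M"
proof -
  interpret M: comm_group M by (rule M)
  let ?h = "coset_factor G t"
  have \<sigma>_cl: "\<sigma> (u, v) \<in> carrier M" if "u \<in> H" "v \<in> H" for u v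
    using \<sigma> that by (auto simp: cocycles2_def PiE_iff)
  have \<sigma>_coc: "\<sigma> (u, v) \<otimes>\<^bsub>M\<^esub> \<sigma> (u \<otimes> v, w) = \<sigma> (v, w) \<otimes>\<^bsub>M\<^esub> \<sigma> (u, v \<otimes> w)"
    if "u \<in> H" "v \<in> H" "w \<in> H" for u v w
    using \<sigma> that by (simp add: cocycles2_def)
  have h: "?h C x \<in> H" if "C \<in> rcosets H" "x \<in> carrier G" for C x
    using coset_factor_in_subgroup[OF H t] that by blast
  note act = r_coset_in_rcosets[OF H]
  have cl: "(\<Otimes>\<^bsub>M\<^esub>C\<in>rcosets H. \<sigma> (?h C x, ?h (C #> x) y)) \<in> carrier M"
    if "x \<in> carrier G" "y \<in> carrier G" for x y
    using that by (intro M.finprod_closed) (auto intro: \<sigma>_cl h act)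
  have "(\<Otimes>\<^bsub>M\<^esub>C\<in>rcosets H. \<sigma> (?h C x, ?h (C #> x) y))
        \<otimes>\<^bsub>M\<^esub> (\<Otimes>\<^bsub>M\<^esub>C\<in>rcosets H. \<sigma> (?h C (x \<otimes> y), ?h (C #> (x \<otimes> y)) z))
      = (\<Otimes>\<^bsub>M\<^esub>C\<in>rcosets H. \<sigma> (?h C y, ?h (C #> y) z))
        \<otimes>\<^bsub>M\<^esub> (\<Otimes>\<^bsub>M\<^esub>C\<in>rcosets H. \<sigma> (?h C x, ?h (C #> x) (y \<otimes> z)))"
    (is "?A \<otimes>\<^bsub>M\<^esub> ?B = ?D \<otimes>\<^bsub>M\<^esub> ?E")
    if x: "x \<in> carrier G" and y: "y \<in> carrier G" and z: "z \<in> carrier G" for x y z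
  proof -
    \<comment> \<open>The factor of \<open>?D\<close> at the coset \<open>C #> x\<close>; since
      right translation by \<open>x\<close> permutes the cosets, the shift disappears in the
      product.\<close>
    let ?D' = "\<lambda>C. \<sigma> (?h (C #> x) y, ?h ((C #> x) #> y) z)"
    have "?A \<otimes>\<^bsub>M\<^esub> ?B = (\<Otimes>\<^bsub>M\<^esub>C\<in>rcosets H.
        \<sigma> (?h C x, ?h (C #> x) y) \<otimes>\<^bsub>M\<^esub> \<sigma> (?h C (x \<otimes> y), ?h (C #> (x \<otimes> y)) z))"
      using x y z by (intro M.finprod_multf[symmetric]) (auto intro!: \<sigma>_cl h act)
    also have "\<dots> = (\<Otimes>\<^bsub>M\<^esub>C\<in>rcosets H. ?D' C \<otimes>\<^bsub>M\<^esub> \<sigma> (?h C x, ?h (C #> x) (y \<otimes> z)))"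
    proof (rule M.finprod_cong')
      fix C assume C: "C \<in> rcosets H"
      then have Cx: "C #> x \<in> rcosets H" and Cxy: "(C #> x) #> y \<in> rcosets H"
        using x y by (auto intro!: act)
      show "\<sigma> (?h C x, ?h (C #> x) y) \<otimes>\<^bsub>M\<^esub> \<sigma> (?h C (x \<otimes> y), ?h (C #> (x \<otimes> y)) z)
          = ?D' C \<otimes>\<^bsub>M\<^esub> \<sigma> (?h C x, ?h (C #> x) (y \<otimes> z))"
        using \<sigma>_coc[OF h[OF C x] h[OF Cx y] h[OF Cxy z]] H C Cx x y z
        by (simp add: coset_factor_mult[OF H t] r_coset_r_coset[OF H])
    qed (use x y z in \<open>auto intro!: \<sigma>_cl h act\<close>)
    also have "\<dots> = (\<Otimes>\<^bsub>M\<^esub>C\<in>rcosets H. ?D' C) \<otimes>\<^bsub>M\<^esub> ?E"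
      using x y z by (intro M.finprod_multf) (auto intro!: \<sigma>_cl h act)
    also have "(\<Otimes>\<^bsub>M\<^esub>C\<in>rcosets H. ?D' C) = ?D"
    proof -
      have bij: "inj_on (\<lambda>C. C #> x) (rcosets H)" "(\<lambda>C. C #> x) ` (rcosets H) = rcosets H"
        using bij_betw_r_coset_rcosets[OF H x] by (auto simp: bij_betw_def)
      have "(\<Otimes>\<^bsub>M\<^esub>C\<in>(\<lambda>C. C #> x) ` (rcosets H). \<sigma> (?h C y, ?h (C #> y) z))
          = (\<Otimes>\<^bsub>M\<^esub>C\<in>rcosets H. ?D' C)"
        by (rule M.finprod_reindex) (use x y z bij in \<open>auto intro!: \<sigma>_cl h act\<close>)
      then show ?thesis
        by (simp add: bij)
    qed
    finally show ?thesis .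
  qed
  then show ?thesis
    by (auto simp: cocycles2_def corestriction2_def cl)
qed

text \<open>All factors of the product coincide by \<open>coset_factor_central\<close>. Restriction
  after corestriction is thus the power map on cocycles themselves, not only on classes. If
  \<open>rcosets H\<close> is infinite, both sides are one, since \<open>card\<close> is then
  0.\<close>

lemma corestriction2_central:
  assumes H: "central_subgroup H G" and t: "\<And>C. C \<in> rcosets H \<Longrightarrow> t C \<in> C"
    and M: "comm_group M" and \<sigma>: "\<sigma> \<in> cocycles2 (G\<lparr>carrier := H\<rparr>) M" and xy: "x \<in> H" "y \<in> H"
  shows "corestriction2 G H M t \<sigma> (x, y) = \<sigma> (x, y) [^]\<^bsub>M\<^esub> card (rcosets H)"
proof -
  interpret M: comm_group M by (rule M)
  interpret H: subgroup H G using H by (simp add: central_subgroup_def)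
  have cl: "\<sigma> (x, y) \<in> carrier M"
    using \<sigma> xy by (auto simp: cocycles2_def PiE_iff)
  have "corestriction2 G H M t \<sigma> (x, y) = (\<Otimes>\<^bsub>M\<^esub>C\<in>rcosets H. \<sigma> (x, y))"
    using xy cl by (auto simp: corestriction2_def coset_factor_central[OF H t] intro!: M.finprod_cong')
  then show ?thesis
    using cl by (simp add: M.finprod_const)
qed

end

theorem corollary3p13:
  fixes G :: "('a, 'c) monoid_scheme" and M :: "('b, 'd) monoid_scheme" and H :: "'a set"
  assumes "group G"
    and "central_subgroup H G"
    and "finite (rcosets\<^bsub>G\<^esub> H)"
    and "comm_group M"
    and "invertible_in (card (rcosets\<^bsub>G\<^esub> H)) M"
  shows "carrier (cohomology2 (G\<lparr>carrier := H\<rparr>) M)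
    = restriction2 G H M ` carrier (cohomology2 G M)"
proof
  interpret G: group G by fact
  interpret M: comm_group M by fact
  let ?H = "G\<lparr>carrier := H\<rparr>"
  let ?n = "card (rcosets\<^bsub>G\<^esub> H)"
  have H: "subgroup H G"
    using assms(2) by (simp add: central_subgroup_def)
  show "restriction2 G H M ` carrier (cohomology2 G M) \<subseteq> carrier (cohomology2 ?H M)"
    using hom_carrier[OF restriction2_hom[OF assms(1,4) H]] .
  \<comment> \<open>Invertibility of the index makes this the two-sided inverse of the power map on
    \<open>carrier M\<close>, and therefore a homomorphism.\<close>
  define root where "root = inv_into (carrier M) (\<lambda>m. m [^]\<^bsub>M\<^esub> ?n)"
  have pow: "(\<lambda>m. m [^]\<^bsub>M\<^esub> ?n) \<in> iso M M"
    using assms(5) by (simp add: invertible_in_def)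
  have root: "root \<in> hom M M"
    using M.iso_set_sym[OF pow] by (simp add: root_def iso_def)
  have root_pow: "root m [^]\<^bsub>M\<^esub> ?n = m" if "m \<in> carrier M" for m
    using pow that unfolding root_def by (auto simp: iso_def bij_betw_def intro: f_inv_into_f)
  define t :: "'a set \<Rightarrow> 'a" where "t C = (SOME a. a \<in> C)" for C
  have t: "t C \<in> C" if "C \<in> rcosets\<^bsub>G\<^esub> H" for C
    using that subgroup.rcosets_non_empty[OF H] by (auto simp: t_def some_in_eq)
  show "carrier (cohomology2 ?H M) \<subseteq> restriction2 G H M ` carrier (cohomology2 G M)"
  proof
    fix A assume "A \<in> carrier (cohomology2 ?H M)"
    then obtain \<tau> where \<tau>: "\<tau> \<in> cocycles2 ?H M" and A: "A = cohomology2_class ?H M \<tau>"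
      by (auto simp: carrier_cohomology2)
    \<comment> \<open>The root is taken before corestricting, so that the power produced by
      corestriction and restriction returns \<open>\<tau>\<close>.\<close>
    define \<rho> where "\<rho> = (\<lambda>p \<in> H \<times> H. root (\<tau> p))"
    have \<rho>: "\<rho> \<in> cocycles2 ?H M"
      using map_cocycles2[OF G.subgroup_imp_group[OF H] root \<tau>] by (simp add: \<rho>_def)
    define \<sigma> where "\<sigma> = corestriction2 G H M t \<rho>"
    have \<sigma>: "\<sigma> \<in> cocycles2 G M"
      unfolding \<sigma>_def using H t assms(4) \<rho> by (rule G.corestriction2_in_cocycles2)
    have \<tau>_ext: "\<tau> \<in> H \<times> H \<rightarrow>\<^sub>E carrier M"
      using \<tau> by (simp add: cocycles2_def)
    have "\<sigma> (x, y) = \<tau> (x, y)" if "x \<in> H" "y \<in> H" for x y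
      using G.corestriction2_central[OF assms(2) t assms(4) \<rho> that] that \<tau>_ext
      by (simp add: \<sigma>_def \<rho>_def root_pow PiE_iff)
    \<comment> \<open>Both functions are extensional on \<open>H \<times> H\<close>, so agreement
      there is equality and no coboundary correction arises.\<close>
    then have "restrict \<sigma> (H \<times> H) = \<tau>"
      using \<tau>_ext by (auto simp: PiE_iff intro!: extensionalityI[of _ "H \<times> H"])
    then have "A = restriction2 G H M (cohomology2_class G M \<sigma>)"
      using restriction2_class[OF assms(1,4) H \<sigma>] A by simp
    then show "A \<in> restriction2 G H M ` carrier (cohomology2 G M)"
      using \<sigma> by (auto simp: carrier_cohomology2)
  qed
qed

end
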